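(* Let $\lambda,x,y$ be indeterminates, and let $\{Q_n\}_{n\ge 0}$ be the sequence of polynomials in $\lambda,x,y$ defined by $Q_0=1$ and, for $n\ge 1$, $$Q_n=\binom{\lambda}{n}(-1)^n-x\sum_{k=1}^n(-1)^k\binom{y}{k}Q_{n-k}.$$ Then for every integer $n\ge 0$, $$Q_n=\sum_{m=0}^n\sum_{k=0}^m(-1)^{n+k}\binom{m}{k}\binom{\lambda+ky}{n}x^m.$$
   Context: For an indeterminate or polynomial $u$ and integer $n\ge 0$, $\binom{u}{n}=\frac{u(u-1)\cdots(u-n+1)}{n!}$ (equal to $1$ for $n=0$). *)

theory Defs
  imports "HOL-Computational_Algebra.Polynomial"
begin

text \<open>
  The polynomial ring in three indeterminates over a field of characteristic 0 is rendered as
  the iterated univariate ring \<open>K[\<lambda>][y][x]\<close>, the innermost variable being \<open>\<lambda>\<close>.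
\<close>

definition indet_lam :: "'a::field_char_0 poly poly poly"
  where "indet_lam = [:[:[:0, 1:]:]:]"

definition indet_y :: "'a::field_char_0 poly poly poly"
  where "indet_y = [:[:0, 1:]:]"

definition indet_x :: "'a::field_char_0 poly poly poly"
  where "indet_x = [:0, 1:]"

text \<open>
  The library's \<open>gchoose\<close> is constrained to fields of characteristic 0 and so does not
  typecheck on a polynomial ring. The first factor below is the constant polynomial \<open>1/n!\<close>.
\<close>

definition poly_choose :: "'a::field_char_0 poly poly poly \<Rightarrow> nat \<Rightarrow> 'a poly poly poly"
  where "poly_choose u n = [:[:[:1 / fact n:]:]:] * (\<Prod>i<n. u - of_nat i)"

lemma poly_choose_0: "poly_choose u 0 = 1"
  by (simp add: poly_choose_def one_pCons)

lemma fact_mult_poly_choose: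
  fixes u :: "'a::field_char_0 poly poly poly"
  shows "fact n * poly_choose u n = (\<Prod>i<n. u - of_nat i)"
proof -
  have "(fact n :: 'a poly poly poly) = of_nat (fact n)"
    by simp
  also have "\<dots> = [:[:[:fact n:]:]:]"
    unfolding of_nat_poly by simp
  finally have "fact n * [:[:[:1 / fact n:]:]:] = (1 :: 'a poly poly poly)"
    by (simp add: one_pCons)
  thus ?thesis
    by (simp only: poly_choose_def mult_1 flip: mult.assoc)
qed

end

theory Submission
  imports Defs "HOL-Computational_Algebra.Formal_Power_Series"
begin

text \<open>
  The proof uses the generating function \<open>Q(t) = \<Sum>n. Q\<^sub>n t\<^sup>n\<close>, a formal power series over the
  polynomial ring. Write \<open>(1 - t)\<^sup>u\<close> for the series with coefficients \<open>(-1)\<^sup>n (u choose n)\<close> and put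
  \<open>z = 1 - (1 - t)\<^sup>y\<close>. Read coefficientwise, the recurrence says
  \<open>Q(t) = (1 - t)\<^sup>\<lambda> + x z Q(t)\<close>, so that \<open>Q(t) = \<Sum>m. x\<^sup>m z\<^sup>m (1 - t)\<^sup>\<lambda>\<close>.
  The series \<open>z\<close> has no constant term, hence \<open>z\<^sup>m\<close> contributes to the coefficient of \<open>t\<^sup>n\<close> only when
  \<open>m \<le> n\<close> (\<open>fps_fixpoint_nth\<close>). By the binomial theorem and the law of exponents
  \<open>(1 - t)\<^sup>u (1 - t)\<^sup>v = (1 - t)\<^sup>u\<^sup>+\<^sup>v\<close>,
  \<open>z\<^sup>m (1 - t)\<^sup>\<lambda> = \<Sum>k\<le>m. (-1)\<^sup>k (m choose k) (1 - t)\<^sup>\<lambda>\<^sup>+\<^sup>k\<^sup>y\<close>, and comparing coefficients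
  gives the formula.

  The law of exponents (\<open>one_minus_pow_add\<close>) is Vandermonde's identity. It is obtained here from
  the fact that \<open>(1 - t)\<^sup>u\<close> is the only solution of \<open>(1 - t) f' = - u f\<close> with constant term \<open>1\<close>
  (\<open>one_minus_pow_unique\<close>): by the product rule, the product of two solutions solves the equation
  for the sum of the exponents.
\<close>

unbundle fps_syntax

lemma poly_choose_Suc:
  "of_nat (Suc n) * poly_choose u (Suc n) = (u - of_nat n) * poly_choose u n"
proof -
  have "fact n * (of_nat (Suc n) * poly_choose u (Suc n)) = fact (Suc n) * poly_choose u (Suc n)"
    by (simp only: fact_Suc of_nat_mult mult_ac)
  also have "\<dots> = (fact n * poly_choose u n) * (u - of_nat n)"
    by (simp only: fact_mult_poly_choose prod.lessThan_Suc)
  finally have "fact n * (of_nat (Suc n) * poly_choose u (Suc n))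
      = fact n * ((u - of_nat n) * poly_choose u n)"
    by (simp only: mult_ac)
  thus ?thesis
    by (simp only: mult_left_cancel[OF fact_nonzero])
qed

text \<open>The binomial series \<open>(1 - t)\<^sup>u\<close>, whose exponent is a polynomial.\<close>

definition one_minus_pow :: "'a::field_char_0 poly poly poly \<Rightarrow> 'a poly poly poly fps"
  where "one_minus_pow u = Abs_fps (\<lambda>n. (-1) ^ n * poly_choose u n)"

lemma one_minus_pow_nth: "one_minus_pow u $ n = (-1) ^ n * poly_choose u n"
  by (simp add: one_minus_pow_def)

text \<open>
  Comparing coefficients of \<open>t\<^sup>n\<close>, the equation \<open>(1 - t) f' = - u f\<close> becomes
  \<open>(n + 1) f\<^sub>n\<^sub>+\<^sub>1 = (n - u) f\<^sub>n\<close>, which is the recurrence of the signed binomial coefficients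
  \<open>(-1)\<^sup>n (u choose n)\<close>. In characteristic 0 it determines \<open>f\<close> from its constant term.
\<close>

lemma one_minus_X_deriv_nth:
  fixes f :: "'b::comm_ring_1 fps"
  shows "((1 - fps_X) * fps_deriv f) $ n = of_nat (Suc n) * f $ Suc n - of_nat n * f $ n"
  by (cases n) (simp_all add: left_diff_distrib)

lemma one_minus_pow_deriv:
  "(1 - fps_X) * fps_deriv (one_minus_pow u) = - fps_const u * one_minus_pow u"
proof (rule fps_ext)
  fix n
  have "of_nat (Suc n) * one_minus_pow u $ Suc n
      = - ((-1) ^ n * (of_nat (Suc n) * poly_choose u (Suc n)))"
    by (simp add: one_minus_pow_nth algebra_simps)
  also have "\<dots> = - ((-1) ^ n * ((u - of_nat n) * poly_choose u n))"
    by (simp only: poly_choose_Suc)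
  finally show "((1 - fps_X) * fps_deriv (one_minus_pow u)) $ n
      = (- fps_const u * one_minus_pow u) $ n"
    unfolding one_minus_X_deriv_nth by (simp add: one_minus_pow_nth algebra_simps)
qed

lemma one_minus_pow_unique:
  assumes "f $ 0 = 1" and ode: "(1 - fps_X) * fps_deriv f = - fps_const u * f"
  shows "f = one_minus_pow u"
proof -
  have step: "of_nat (Suc n) * g $ Suc n = (of_nat n - u) * g $ n"
    if "(1 - fps_X) * fps_deriv g = - fps_const u * g" for g n
  proof -
    have "((1 - fps_X) * fps_deriv g) $ n = (- fps_const u * g) $ n"
      by (simp only: that)
    thus ?thesis
      unfolding one_minus_X_deriv_nth by (simp add: algebra_simps)
  qed
  have "f $ n = one_minus_pow u $ n" for n
  proof (induction n)
    case 0
    show ?case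
      by (simp add: assms one_minus_pow_nth poly_choose_0)
  next
    case (Suc n)
    have "of_nat (Suc n) * f $ Suc n = of_nat (Suc n) * one_minus_pow u $ Suc n"
      by (simp only: step[OF ode] step[OF one_minus_pow_deriv] Suc)
    thus ?case
      by (simp only: mult_left_cancel[OF of_nat_neq_0])
  qed
  thus ?thesis
    by (rule fps_ext)
qed

lemma one_minus_pow_add: "one_minus_pow (u + v) = one_minus_pow u * one_minus_pow v"
proof (rule sym, rule one_minus_pow_unique)
  show "(one_minus_pow u * one_minus_pow v) $ 0 = 1"
    by (simp add: one_minus_pow_nth poly_choose_0)
  have "(1 - fps_X) * fps_deriv (one_minus_pow u * one_minus_pow v)
      = one_minus_pow u * ((1 - fps_X) * fps_deriv (one_minus_pow v))
        + (1 - fps_X) * fps_deriv (one_minus_pow u) * one_minus_pow v"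
    by (simp only: fps_deriv_mult distrib_left mult_ac)
  also have "\<dots> = - fps_const (u + v) * (one_minus_pow u * one_minus_pow v)"
    unfolding one_minus_pow_deriv fps_const_add[symmetric]
    by (simp only: minus_add_distrib algebra_simps)
  finally show "(1 - fps_X) * fps_deriv (one_minus_pow u * one_minus_pow v)
      = - fps_const (u + v) * (one_minus_pow u * one_minus_pow v)" .
qed

lemma one_minus_pow_0: "one_minus_pow 0 = 1"
  by (rule sym, rule one_minus_pow_unique) simp_all

lemma one_minus_pow_of_nat_mult: "one_minus_pow (of_nat k * u) = one_minus_pow u ^ k"
  by (induction k) (simp_all add: one_minus_pow_0 one_minus_pow_add distrib_right)

text \<open>
  Iterating \<open>f = b + a f\<close> gives \<open>f = b + a b + \<dots> + a\<^sup>n b + a\<^sup>n\<^sup>+\<^sup>1 f\<close>. When \<open>a\<close> has no constant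
  term, \<open>a\<^sup>n\<^sup>+\<^sup>1\<close> starts in degree \<open>n + 1\<close> or later, so the remainder is invisible in degree \<open>n\<close>.
\<close>

lemma fps_fixpoint_nth:
  fixes a b f :: "'b::comm_ring_1 fps"
  assumes eq: "f = b + a * f" and "a $ 0 = 0"
  shows "f $ n = (\<Sum>m\<le>n. (a ^ m * b) $ n)"
proof -
  have unrolled: "f = (\<Sum>m\<le>N. a ^ m * b) + a ^ Suc N * f" for N
  proof (induction N)
    case 0
    show ?case
      by (simp flip: eq)
  next
    case (Suc N)
    have "a ^ Suc N * f = a ^ Suc N * (b + a * f)"
      by (rule arg_cong[OF eq])
    also have "\<dots> = a ^ Suc N * b + a ^ Suc (Suc N) * f"
      by (simp add: algebra_simps)
    finally show ?case
      using Suc by (simp add: add.assoc)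
  qed
  have "(a ^ Suc n * f) $ n = 0"
    using startsby_zero_power_prefix[OF \<open>a $ 0 = 0\<close>, of "Suc n"] by (auto simp: fps_mult_nth)
  thus ?thesis
    by (subst unrolled[of n]) (simp add: fps_sum_nth)
qed

theorem proposition3:
  fixes Q :: "nat \<Rightarrow> 'a::field_char_0 poly poly poly" and n :: nat
  assumes "Q 0 = 1"
    and "\<And>n. n \<ge> 1 \<Longrightarrow>
      Q n = poly_choose indet_lam n * (-1) ^ n
            - indet_x * (\<Sum>k=1..n. (-1) ^ k * poly_choose indet_y k * Q (n - k))"
  shows "Q n = (\<Sum>m=0..n. \<Sum>k=0..m.
      (-1) ^ (n + k) * of_nat (m choose k)
        * poly_choose (indet_lam + of_nat k * indet_y) n * indet_x ^ m)"
proof -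
  define z :: "'a poly poly poly fps" where "z = 1 - one_minus_pow indet_y"
  have z0: "z $ 0 = 0"
    by (simp add: z_def one_minus_pow_nth poly_choose_0)
  have "Abs_fps Q = one_minus_pow indet_lam + fps_const indet_x * z * Abs_fps Q"
  proof (rule fps_ext)
    fix n
    \<comment> \<open>The recurrence has no term for \<open>k = 0\<close>, which matches the missing constant term of \<open>z\<close>.\<close>
    have "(z * Abs_fps Q) $ n = (\<Sum>k=1..n. z $ k * Q (n - k))"
      by (simp add: fps_mult_nth sum.atLeast_Suc_atMost[of 0] z0)
    also have "\<dots> = - (\<Sum>k=1..n. (-1) ^ k * poly_choose indet_y k * Q (n - k))"
      unfolding sum_negf[symmetric]
      by (rule sum.cong) (simp_all add: z_def one_minus_pow_nth)
    finally show "Abs_fps Q $ n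
        = (one_minus_pow indet_lam + fps_const indet_x * z * Abs_fps Q) $ n"
      using assms by (cases "n = 0") (simp_all add: one_minus_pow_nth poly_choose_0 mult.assoc)
  qed
  from fps_fixpoint_nth[OF this, of n]
  have "Q n = (\<Sum>m\<le>n. ((fps_const indet_x * z) ^ m * one_minus_pow indet_lam) $ n)"
    by (simp add: z0)
  moreover have "((fps_const indet_x * z) ^ m * one_minus_pow indet_lam) $ n
      = (\<Sum>k=0..m. (-1) ^ (n + k) * of_nat (m choose k)
          * poly_choose (indet_lam + of_nat k * indet_y) n * indet_x ^ m)" for m
  proof -
    have "z ^ m = (\<Sum>k\<le>m. of_nat (m choose k) * (- one_minus_pow indet_y) ^ k)"
      using binomial_ring[of "- one_minus_pow indet_y" 1 m] by (simp add: z_def)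
    also have "\<dots> = (\<Sum>k\<le>m. fps_const ((-1) ^ k * of_nat (m choose k))
        * one_minus_pow (of_nat k * indet_y))"
    proof (rule sum.cong)
      fix k
      have "fps_const (-1 :: 'a poly poly poly) = -1"
        by (metis fps_const_1_eq_1 fps_const_neg)
      hence "fps_const ((-1) ^ k * of_nat (m choose k) :: 'a poly poly poly)
          = (-1) ^ k * of_nat (m choose k)"
        by (simp add: fps_of_nat flip: fps_const_mult fps_const_power)
      thus "of_nat (m choose k) * (- one_minus_pow (indet_y :: 'a poly poly poly)) ^ k
          = fps_const ((-1) ^ k * of_nat (m choose k)) * one_minus_pow (of_nat k * indet_y)"
        unfolding one_minus_pow_of_nat_mult power_minus[of "one_minus_pow indet_y"]
        by (simp only: mult_ac)
    qed simp
    finally have "z ^ m * one_minus_pow indet_lam = (\<Sum>k\<le>m.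
        fps_const ((-1) ^ k * of_nat (m choose k))
        * one_minus_pow (indet_lam + of_nat k * indet_y))"
      by (simp only: sum_distrib_left one_minus_pow_add mult_ac)
    hence "(z ^ m * one_minus_pow indet_lam) $ n = (\<Sum>k=0..m. (-1) ^ (n + k)
        * of_nat (m choose k) * poly_choose (indet_lam + of_nat k * indet_y) n)"
      by (simp add: fps_sum_nth one_minus_pow_nth power_add mult_ac atLeast0AtMost)
    moreover have "(fps_const indet_x * z) ^ m * one_minus_pow indet_lam
        = fps_const (indet_x ^ m) * (z ^ m * one_minus_pow indet_lam)"
      by (simp add: power_mult_distrib fps_const_power mult.assoc)
    ultimately have "((fps_const indet_x * z) ^ m * one_minus_pow indet_lam) $ n
        = indet_x ^ m * (\<Sum>k=0..m. (-1) ^ (n + k)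
            * of_nat (m choose k) * poly_choose (indet_lam + of_nat k * indet_y) n)"
      by (simp only: fps_mult_left_const_nth)
    thus ?thesis
      by (simp only: sum_distrib_left mult_ac)
  qed
  ultimately show ?thesis
    by (simp add: atLeast0AtMost)
qed

end
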